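(* Consider uncertain-horizon (randomly-terminated) problems on a fixed finite directed graph with nodes $X=\{x_1,\dots,x_M\}$, transition costs $K_{ij}$ and terminal costs $q_i$, for varying termination probability $p$. Assume that (A1) $x_i\in N(x_i)$ for every $x_i\in X$; (A2) $K_{ii}=0$ for every $i$; (A3) there is a constant $\Delta\ge 0$ with $K_{ij}\ge\Delta$ for all $i$ and all $j\ne i$. Then: 1. Let $p\in(0,1)$ and let $\mathbf{y}=(y_0,\dots,y_m,y_m,\dots)$ be a $p$-optimal eventually motionless path leading from $x=y_0$ to $y_m$. Then $Cost(y_0,\dots,y_m)\le Cost(y_0,\dots,y_n)$ and $q(y_m)\le q(y_n)$ for all $n<m$ (and the second inequality becomes strict if $\Delta>0$). 2. $V^p(x)\in[V^0(x),V^1(x)]$ for all $p\in(0,1)$ and all $x\in X$. 3. If $0<p_1\le p_2<1$, then $V^{p_1}(x)\le V^{p_2}(x)$ for all $x\in X$. 4. $V^p(x_i)\to V^1(x_i)$ as $p\to1$, for all $x_i\in X$. 5. $V^p(x_i)\to V^0(x_i)$ as $p\to0$, for all $x_i\in X$. 6. If $p_1\le p_2$, then $\mathcal{M}^{p_1}\subset\mathcal{M}^{p_2}$. In particular $\mathcal{M}^0\subset\mathcal{M}^p\subset\mathcal{M}^1$ for all $p\in(0,1)$. 7. For every $x_i\in\mathcal{M}^1_0$ there exists a sufficiently large $p<1$ such that $x_i\in\mathcal{M}^p$. 8. For every $x_i\notin\mathcal{M}^0$ there exists a sufficiently small $p>0$ such that $x_i\notin\mathcal{M}^p$. 9. Let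 $Q_l=\{x_i\mid q(x_i)\le q(x_j)\ \forall x_j\in N(x_i)\}$ and $Q_g=\{x_i\mid q(x_i)\le q(x_j)\ \forall x_j\in X\}$. Then $Q_g\subset\mathcal{M}^0$ and $Q_l\subset\mathcal{M}^1$; and if all $K_{ij}=0$ (for $x_j\in N(x_i)$), then $Q_l=\mathcal{M}^1$.
   Context: $N(x_i)\subset X$ is the set of nodes to which a direct transition from $x_i$ is possible, and $\hat N(x_i)=N(x_i)\setminus\{x_i\}$. A transition from $x_i$ to $x_j\in N(x_i)$ has real cost $K_{ij}=K(x_i,x_j)$ (and $K_{ij}=+\infty$ if $x_j\notin N(x_i)$); $q_i=q(x_i)\in\mathbb{R}$ is the terminal cost at $x_i$. A path is an infinite sequence $\mathbf{y}=(y_0,y_1,\dots)$ with $y_{k+1}\in N(y_k)$ for all $k\ge0$; it is eventually motionless if $y_k=y_m$ for all $k\ge m$, for some $m\ge0$. For a finite path, $Cost(y_0,\dots,y_t)=\sum_{k=0}^{t-1}K(y_k,y_{k+1})+q(y_t)$ (so $Cost(y_0)=q(y_0)$). For $p\in(0,1)$ the process terminates with probability $p$ after each transition, the expected cost of a path is $J^p(\mathbf{y})=\sum_{t=1}^\infty (1-p)^{t-1}p\,Cost(y_0,\dots,y_t)$, and $V^p(x)=\min J^p(\mathbf{y})$ over all paths with $y_0=x$. A path from $x$ is $p$-optimal if $J^p(\mathbf{y})=V^p(x)$. The limiting functions are: $V^0$, the solution of the system $V^0_i=\min\{\min_{x_j\in\hat N(x_i)}\{K_{ij}+V^0_j\},\,q_i\}$,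 $i=1,\dots,M$, understood as the value function of the undiscounted deterministic optimal stopping problem, i.e. $V^0(x)=\min Cost(y_0,\dots,y_m)$ over all $m\ge0$ and all finite paths with $y_0=x$; and $V^1(x_i)=\min_{x_j\in N(x_i)}\{K_{ij}+q_j\}$. For $p\in[0,1]$ the motionless set is $\mathcal{M}^p=\{x\in X\mid V^p(x)=q(x)\}$. Finally $\mathcal{M}^1_0=\{x_i\in X\mid q_i<K_{ij}+q_j\ \ \forall x_j\in\hat N(x_i)\}$.
   Formalization: In item 1, the strict inequality q(y_m)<q(y_n) for Δ>0 is stated for m the first index from which the path is motionless; for a later m it fails, since then y_{m-1}=y_m. *)

theory Defs
  imports Complex_Main
begin

text \<open>
  A problem is given by a node set \<open>X\<close>, successor sets \<open>N x\<close>, transition costs \<open>K\<close> and terminal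
  costs \<open>q\<close>. The convention that \<open>K x y\<close> is infinite for \<open>y \<notin> N x\<close> is rendered by never reading
  \<open>K\<close> off the edges, so that \<open>K\<close> may be real-valued.
\<close>

definition proper_succ :: "('a \<Rightarrow> 'a set) \<Rightarrow> 'a \<Rightarrow> 'a set" where
  "proper_succ N x = N x - {x}"

definition is_path :: "'a set \<Rightarrow> ('a \<Rightarrow> 'a set) \<Rightarrow> (nat \<Rightarrow> 'a) \<Rightarrow> bool" where
  "is_path X N y \<longleftrightarrow> (\<forall>k. y k \<in> X \<and> y (Suc k) \<in> N (y k))"

text \<open>Only the values \<open>y 0, \<dots>, y m\<close> matter; they encode a finite path.\<close>

definition is_finite_path :: "'a set \<Rightarrow> ('a \<Rightarrow> 'a set) \<Rightarrow> nat \<Rightarrow> (nat \<Rightarrow> 'a) \<Rightarrow> bool" where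
  "is_finite_path X N m y \<longleftrightarrow> (\<forall>k\<le>m. y k \<in> X) \<and> (\<forall>k<m. y (Suc k) \<in> N (y k))"

definition motionless_from :: "(nat \<Rightarrow> 'a) \<Rightarrow> nat \<Rightarrow> bool" where
  "motionless_from y m \<longleftrightarrow> (\<forall>k\<ge>m. y k = y m)"

definition path_cost :: "('a \<Rightarrow> 'a \<Rightarrow> real) \<Rightarrow> ('a \<Rightarrow> real) \<Rightarrow> (nat \<Rightarrow> 'a) \<Rightarrow> nat \<Rightarrow> real" where
  "path_cost K q y t = (\<Sum>k<t. K (y k) (y (Suc k))) + q (y t)"

text \<open>The summation index is \<open>t - 1\<close> for the termination time \<open>t = 1, 2, \<dots>\<close>.\<close>

definition expected_cost ::
    "('a \<Rightarrow> 'a \<Rightarrow> real) \<Rightarrow> ('a \<Rightarrow> real) \<Rightarrow> real \<Rightarrow> (nat \<Rightarrow> 'a) \<Rightarrow> real" where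
  "expected_cost K q p y = (\<Sum>t. (1 - p) ^ t * p * path_cost K q y (Suc t))"

text \<open>
  The value functions are genuine minima: \<open>LEAST\<close> denotes the minimum of a set of reals
  if the minimum is attained, and is unspecified otherwise.
\<close>

definition V_rand :: "'a set \<Rightarrow> ('a \<Rightarrow> 'a set) \<Rightarrow> ('a \<Rightarrow> 'a \<Rightarrow> real) \<Rightarrow> ('a \<Rightarrow> real)
    \<Rightarrow> real \<Rightarrow> 'a \<Rightarrow> real" where
  "V_rand X N K q p x =
     (LEAST v. v \<in> {expected_cost K q p y | y. is_path X N y \<and> y 0 = x})"

definition V_stop :: "'a set \<Rightarrow> ('a \<Rightarrow> 'a set) \<Rightarrow> ('a \<Rightarrow> 'a \<Rightarrow> real) \<Rightarrow> ('a \<Rightarrow> real)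
    \<Rightarrow> 'a \<Rightarrow> real" where
  "V_stop X N K q x =
     (LEAST v. v \<in> {path_cost K q y m | y m. is_finite_path X N m y \<and> y 0 = x})"

definition V_one :: "('a \<Rightarrow> 'a set) \<Rightarrow> ('a \<Rightarrow> 'a \<Rightarrow> real) \<Rightarrow> ('a \<Rightarrow> real) \<Rightarrow> 'a \<Rightarrow> real" where
  "V_one N K q x = Min ((\<lambda>z. K x z + q z) ` N x)"

text \<open>The family \<open>V\<^sup>p\<close> for \<open>p \<in> [0,1]\<close>; the two endpoints have their own definitions.\<close>

definition V :: "'a set \<Rightarrow> ('a \<Rightarrow> 'a set) \<Rightarrow> ('a \<Rightarrow> 'a \<Rightarrow> real) \<Rightarrow> ('a \<Rightarrow> real)
    \<Rightarrow> real \<Rightarrow> 'a \<Rightarrow> real" where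
  "V X N K q p x =
     (if p = 0 then V_stop X N K q x
      else if p = 1 then V_one N K q x
      else V_rand X N K q p x)"

definition p_optimal :: "'a set \<Rightarrow> ('a \<Rightarrow> 'a set) \<Rightarrow> ('a \<Rightarrow> 'a \<Rightarrow> real) \<Rightarrow> ('a \<Rightarrow> real)
    \<Rightarrow> real \<Rightarrow> (nat \<Rightarrow> 'a) \<Rightarrow> bool" where
  "p_optimal X N K q p y \<longleftrightarrow> is_path X N y \<and> expected_cost K q p y = V X N K q p (y 0)"

definition motionless_set :: "'a set \<Rightarrow> ('a \<Rightarrow> 'a set) \<Rightarrow> ('a \<Rightarrow> 'a \<Rightarrow> real) \<Rightarrow> ('a \<Rightarrow> real)
    \<Rightarrow> real \<Rightarrow> 'a set" where
  "motionless_set X N K q p = {x \<in> X. V X N K q p x = q x}"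

definition strict_motionless_one :: "'a set \<Rightarrow> ('a \<Rightarrow> 'a set) \<Rightarrow> ('a \<Rightarrow> 'a \<Rightarrow> real) \<Rightarrow> ('a \<Rightarrow> real)
    \<Rightarrow> 'a set" where
  "strict_motionless_one X N K q = {x \<in> X. \<forall>z\<in>proper_succ N x. q x < K x z + q z}"

definition local_minimizers :: "'a set \<Rightarrow> ('a \<Rightarrow> 'a set) \<Rightarrow> ('a \<Rightarrow> real) \<Rightarrow> 'a set" where
  "local_minimizers X N q = {x \<in> X. \<forall>z\<in>N x. q x \<le> q z}"

definition global_minimizers :: "'a set \<Rightarrow> ('a \<Rightarrow> real) \<Rightarrow> 'a set" where
  "global_minimizers X q = {x \<in> X. \<forall>z\<in>X. q x \<le> q z}"

end

(*
  Conditioning on the first transition gives the Bellman equation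
  V^p(x) = min over z in N(x) of K(x,z) + p q(z) + (1-p) V^p(z).
  Most comparisons of value functions W, W' have the same shape: at each node x the difference
  D = W - W' satisfies D(x) <= (1-p) D(z) for some successor z, so its maximum over the finite graph is at
  most 0. Existence of an optimal path is such a comparison too, between the infimum of the costs
  and the cost of the path that is greedy for this infimum.
*)
theory Submission
  imports Defs
begin

text \<open>The contraction factor 1 - p drives the comparisons, and it is lost at p = 0: with Delta
  = 0 there may be cycles of cost 0, and then the system for V^0 need not have a unique solution.
  Hence V^0 is handled through finite paths, and in the comparison with V^p it is only the smaller
  function, for which a one-step inequality suffices. Both limits come with explicit errors from one
  bound C on q - V^p that is uniform in p: a single transition gives V^1 - V^p <= (1-p) C, and a
  fixed optimal stopping path with m transitions gives V^p - V^0 <= m p C. Monotonicity in p then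
  extends a statement about one p near an endpoint to all p still nearer to it. Attainment of the
  minima comes before all this, because a \<open>LEAST\<close> over reals without a minimum is
  unspecified.\<close>

lemma contracting_imp_nonpos:
  fixes D :: "'a \<Rightarrow> real"
  assumes "finite X" "c < 1"
    and step: "\<And>x. x \<in> X \<Longrightarrow> \<exists>z\<in>X. D x \<le> c * D z"
    and "0 \<le> c" "x \<in> X"
  shows "D x \<le> 0"
proof -
  have fin: "finite (D ` X)" "D ` X \<noteq> {}" using assms by auto
  define M where "M = Max (D ` X)"
  have le: "D z \<le> M" if "z \<in> X" for z using fin that by (simp add: M_def)
  obtain u where u: "u \<in> X" "D u = M" using Max_in[OF fin] by (auto simp: M_def)
  obtain z where z: "z \<in> X" "D u \<le> c * D z" using step[OF u(1)] by blast
  have "M \<le> c * M" using z u le[OF z(1)] mult_left_mono[OF le[OF z(1)] \<open>0 \<le> c\<close>] by linarith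
  hence "(1 - c) * M \<le> 0" by (simp add: algebra_simps)
  hence "M \<le> 0" using \<open>c < 1\<close> by (simp add: mult_le_0_iff)
  thus ?thesis using le[OF \<open>x \<in> X\<close>] by linarith
qed

section \<open>Splitting and prolonging paths\<close>

lemma path_cost_0 [simp]: "path_cost K q y 0 = q (y 0)"
  by (simp add: path_cost_def)

lemma path_cost_Suc:
  "path_cost K q y (Suc t) = K (y 0) (y 1) + path_cost K q (\<lambda>k. y (Suc k)) t"
  by (simp add: path_cost_def sum.lessThan_Suc_shift del: sum.lessThan_Suc)

text \<open>Stopping at time n and going on to time m share the first n transitions, so comparing
  the two costs amounts to comparing \<open>q (y n)\<close> with the cost of the remaining
  path.\<close>

lemma path_cost_split:
  assumes "n \<le> m"
  shows "path_cost K q y m = (\<Sum>k<n. K (y k) (y (Suc k))) + path_cost K q (\<lambda>k. y (n + k)) (m - n)"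
  using assms
proof (induction n arbitrary: y m)
  case (Suc n)
  then obtain m' where "m = Suc m'" "n \<le> m'" by (cases m) auto
  with Suc.IH[of m' "\<lambda>k. y (Suc k)"] show ?case
    by (simp add: path_cost_Suc sum.lessThan_Suc_shift del: sum.lessThan_Suc)
qed simp

lemma is_path_Suc: "is_path X N y \<Longrightarrow> is_path X N (\<lambda>k. y (Suc k))"
  by (simp add: is_path_def)

lemma is_path_case_nat:
  "is_path X N y \<Longrightarrow> x \<in> X \<Longrightarrow> y 0 \<in> N x \<Longrightarrow> is_path X N (case_nat x y)"
  by (auto simp: is_path_def split: nat.split)

lemma is_finite_path_Suc: "is_finite_path X N (Suc m) y \<Longrightarrow> is_finite_path X N m (\<lambda>k. y (Suc k))"
  by (simp add: is_finite_path_def)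

lemma is_finite_path_case_nat:
  "is_finite_path X N m y \<Longrightarrow> x \<in> X \<Longrightarrow> y 0 \<in> N x \<Longrightarrow> is_finite_path X N (Suc m) (case_nat x y)"
  by (auto simp: is_finite_path_def split: nat.split)

text \<open>The weights are the probabilities of the termination times and add up to 1.\<close>

lemma geometric_weights_sums:
  fixes p :: real
  assumes "p \<in> {0<..<1}"
  shows "(\<lambda>t. (1 - p) ^ t * p * c) sums c"
proof -
  have "(\<lambda>t. (1 - p) ^ t) sums (1 / (1 - (1 - p)))"
    by (rule geometric_sums) (use assms in auto)
  from sums_mult2[OF this, of "p * c"] show ?thesis using assms by (simp add: mult.assoc)
qed

text \<open>\<open>K_nonneg\<close> merges A2 and A3. The value of Delta itself enters only with the
  strict inequality between terminal costs and is supplied there.\<close>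

locale stopping_problem =
  fixes X :: "'a set" and N :: "'a \<Rightarrow> 'a set"
    and K :: "'a \<Rightarrow> 'a \<Rightarrow> real" and q :: "'a \<Rightarrow> real"
  assumes finX: "finite X"
    and NX: "x \<in> X \<Longrightarrow> N x \<subseteq> X"
    and refl_N: "x \<in> X \<Longrightarrow> x \<in> N x"
    and K_refl: "x \<in> X \<Longrightarrow> K x x = 0"
    and K_nonneg: "x \<in> X \<Longrightarrow> z \<in> N x \<Longrightarrow> 0 \<le> K x z"
begin

abbreviation "J \<equiv> expected_cost K q"
abbreviation "W \<equiv> V X N K q"

lemma finite_N: "x \<in> X \<Longrightarrow> finite (N x)"
  using NX finX finite_subset by blast

lemma N_in_X: "x \<in> X \<Longrightarrow> z \<in> N x \<Longrightarrow> z \<in> X"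
  using NX by blast

lemma is_path_const: "x \<in> X \<Longrightarrow> is_path X N (\<lambda>_. x)"
  by (simp add: is_path_def refl_N)

lemma q_bounded: obtains C where "0 \<le> C" "\<And>x. x \<in> X \<Longrightarrow> \<bar>q x\<bar> \<le> C"
proof (rule that)
  show "0 \<le> (\<Sum>x\<in>X. \<bar>q x\<bar>)" by (simp add: sum_nonneg)
  show "\<bar>q x\<bar> \<le> (\<Sum>x\<in>X. \<bar>q x\<bar>)" if "x \<in> X" for x
    using member_le_sum[of x X "\<lambda>x. \<bar>q x\<bar>"] that finX by auto
qed

lemma K_bounded: obtains C where "0 \<le> C" "\<And>x z. x \<in> X \<Longrightarrow> z \<in> X \<Longrightarrow> \<bar>K x z\<bar> \<le> C"
proof (rule that)
  show "0 \<le> (\<Sum>(x, z)\<in>X \<times> X. \<bar>K x z\<bar>)" by (intro sum_nonneg) auto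
  show "\<bar>K x z\<bar> \<le> (\<Sum>(x, z)\<in>X \<times> X. \<bar>K x z\<bar>)" if "x \<in> X" "z \<in> X" for x z
    using member_le_sum[of "(x, z)" "X \<times> X" "\<lambda>(x, z). \<bar>K x z\<bar>"] that finX by auto
qed

lemma path_cost_ge:
  assumes "\<And>x. x \<in> X \<Longrightarrow> c \<le> q x" "is_finite_path X N m y"
  shows "c \<le> path_cost K q y m"
proof -
  have "0 \<le> (\<Sum>k<m. K (y k) (y (Suc k)))"
    using assms(2) by (intro sum_nonneg K_nonneg) (auto simp: is_finite_path_def)
  moreover have "c \<le> q (y m)" using assms by (auto simp: is_finite_path_def)
  ultimately show ?thesis by (simp add: path_cost_def)
qed

lemma is_finite_path_is_path: "is_path X N y \<Longrightarrow> is_finite_path X N m y"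
  by (simp add: is_path_def is_finite_path_def)

section \<open>The expected cost of a path\<close>

text \<open>On a finite graph costs grow at most linearly with time, so the derivative of the
  geometric series is a majorant.\<close>

lemma expected_cost_summable:
  assumes p: "p \<in> {0<..<1}" and y: "is_path X N y"
  shows "summable (\<lambda>t. (1 - p) ^ t * p * path_cost K q y (Suc t))"
proof -
  obtain A where A: "0 \<le> A" "\<And>x z. x \<in> X \<Longrightarrow> z \<in> X \<Longrightarrow> \<bar>K x z\<bar> \<le> A" using K_bounded by metis
  obtain B where B: "0 \<le> B" "\<And>x. x \<in> X \<Longrightarrow> \<bar>q x\<bar> \<le> B" using q_bounded by metis
  have yX: "y k \<in> X" for k using y by (simp add: is_path_def)
  have bound: "\<bar>path_cost K q y (Suc t)\<bar> \<le> (A + B) * real (Suc t)" for t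
  proof -
    have "\<bar>\<Sum>k<Suc t. K (y k) (y (Suc k))\<bar> \<le> (\<Sum>k<Suc t. A)"
      by (rule order.trans[OF sum_abs sum_mono]) (rule A(2)[OF yX yX])
    hence "\<bar>path_cost K q y (Suc t)\<bar> \<le> A * real (Suc t) + B"
      using B(2)[OF yX, of "Suc t"] by (simp add: path_cost_def algebra_simps)
    also have "\<dots> \<le> (A + B) * real (Suc t)" using B(1) by (simp add: algebra_simps)
    finally show ?thesis .
  qed
  have "summable (\<lambda>t. of_nat (Suc t) * (1 - p) ^ t)"
    using geometric_deriv_sums[of "1 - p"] p by (auto simp: sums_iff)
  hence "summable (\<lambda>t. p * (A + B) * (of_nat (Suc t) * (1 - p) ^ t))" by (rule summable_mult)
  moreover have "norm ((1 - p) ^ t * p * path_cost K q y (Suc t))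
      \<le> p * (A + B) * (of_nat (Suc t) * (1 - p) ^ t)" for t
  proof -
    have "norm ((1 - p) ^ t * p * path_cost K q y (Suc t))
        = (1 - p) ^ t * p * \<bar>path_cost K q y (Suc t)\<bar>"
      using p by (simp add: abs_mult)
    also have "\<dots> \<le> (1 - p) ^ t * p * ((A + B) * real (Suc t))"
      using p by (intro mult_left_mono bound) auto
    finally show ?thesis by (simp add: mult_ac)
  qed
  ultimately show ?thesis by (rule summable_comparison_test'[where N = 0])
qed

lemma expected_cost_Suc:
  assumes p: "p \<in> {0<..<1}" and y: "is_path X N y"
  shows "J p y = K (y 0) (y 1) + p * q (y 1) + (1 - p) * J p (\<lambda>k. y (Suc k))"
proof -
  let ?s = "\<lambda>k. y (Suc k)"
  \<comment> \<open>Here the tail is charged after t transitions. \<open>f 0\<close> is the event of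
    termination right after the first transition, contributing \<open>p * q (y 1)\<close>; the
    remaining terms are 1 - p times the series of the tail.\<close>
  define f where "f t = (1 - p) ^ t * p * path_cost K q ?s t" for t
  have "(\<lambda>t. (1 - p) ^ t * p * path_cost K q ?s (Suc t)) sums J p ?s"
    unfolding expected_cost_def
    by (rule summable_sums[OF expected_cost_summable[OF p is_path_Suc[OF y]]])
  from sums_mult[OF this, of "1 - p"] have "(\<lambda>t. f (Suc t)) sums ((1 - p) * J p ?s)"
    by (simp add: f_def mult_ac)
  hence "f sums ((1 - p) * J p ?s + f 0)" by (rule sums_Suc)
  from sums_add[OF geometric_weights_sums[OF p, of "K (y 0) (y 1)"] this]
  have "(\<lambda>t. (1 - p) ^ t * p * path_cost K q y (Suc t))
      sums (K (y 0) (y 1) + ((1 - p) * J p ?s + f 0))"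
    by (simp add: f_def path_cost_Suc algebra_simps)
  thus ?thesis by (simp add: expected_cost_def sums_iff f_def)
qed

text \<open>The constant path is its own tail, so the recursion is a linear equation for its
  cost.\<close>

lemma expected_cost_const:
  assumes p: "p \<in> {0<..<1}" and "x \<in> X"
  shows "J p (\<lambda>_. x) = q x"
proof -
  have "p * J p (\<lambda>_. x) = p * q x"
    using expected_cost_Suc[OF p is_path_const[OF assms(2)]] K_refl[OF assms(2)]
    by (simp add: algebra_simps)
  thus ?thesis using p by simp
qed

lemma expected_cost_ge:
  assumes p: "p \<in> {0<..<1}" and y: "is_path X N y" and c: "\<And>x. x \<in> X \<Longrightarrow> c \<le> q x"
  shows "c \<le> J p y"
  unfolding expected_cost_def
proof (rule sums_le[OF _ geometric_weights_sums[OF p]])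
  show "(\<lambda>t. (1 - p) ^ t * p * path_cost K q y (Suc t))
      sums (\<Sum>t. (1 - p) ^ t * p * path_cost K q y (Suc t))"
    by (rule summable_sums[OF expected_cost_summable[OF p y]])
  show "(1 - p) ^ t * p * c \<le> (1 - p) ^ t * p * path_cost K q y (Suc t)" for t
    using p by (intro mult_left_mono path_cost_ge c is_finite_path_is_path[OF y]) auto
qed

section \<open>Optimal paths and the Bellman equation\<close>

lemma optimal_path_exists:
  assumes p: "p \<in> {0<..<1}" and x: "x \<in> X"
  shows "\<exists>y. is_path X N y \<and> y 0 = x \<and> (\<forall>y'. is_path X N y' \<and> y' 0 = x \<longrightarrow> J p y \<le> J p y')"
proof -
  define S where "S x = {J p y | y. is_path X N y \<and> y 0 = x}" for x
  define U where "U x = Inf (S x)" for x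
  obtain C where C: "\<And>x. x \<in> X \<Longrightarrow> \<bar>q x\<bar> \<le> C" using q_bounded by metis
  have bdd: "bdd_below (S x)" for x
    unfolding S_def by (rule bdd_belowI[of _ "- C"]) (use expected_cost_ge[OF p] C in force)
  have U_le: "U (y 0) \<le> J p y" if "is_path X N y" for y
    unfolding U_def by (rule cInf_lower[OF _ bdd]) (use that in \<open>auto simp: S_def\<close>)
  \<comment> \<open>The right-hand side of the Bellman equation, with the infimum \<open>U\<close>
    in place of the value function, which is not yet known to be a minimum.\<close>
  let ?h = "\<lambda>x z. K x z + p * q z + (1 - p) * U z"
  have "\<exists>z\<in>N x. ?h x z \<le> U x" if x: "x \<in> X" for x
  proof -
    have "finite (N x)" "N x \<noteq> {}" using finite_N refl_N x by auto
    then obtain z where z: "z \<in> N x" "\<And>w. w \<in> N x \<Longrightarrow> ?h x z \<le> ?h x w"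
      using ex_is_arg_min_if_finite[of "N x" "?h x"] by (force simp: is_arg_min_linorder)
    have "?h x z \<le> U x"
      unfolding U_def
    proof (rule cInf_greatest)
      show "S x \<noteq> {}" using is_path_const[OF x] by (auto simp: S_def)
      fix s assume "s \<in> S x"
      then obtain y where y: "is_path X N y" "y 0 = x" "s = J p y" by (auto simp: S_def)
      have "y 1 \<in> N x" using y by (metis is_path_def One_nat_def)
      hence "?h x z \<le> ?h x (y 1)" by (rule z(2))
      also have "\<dots> \<le> s"
        using expected_cost_Suc[OF p y(1)] y(2,3) U_le[OF is_path_Suc[OF y(1)]] p
        by (simp add: mult_left_mono)
      finally show "K x z + p * q z + (1 - p) * Inf (S z) \<le> s" by (simp add: U_def)
    qed
    with z show ?thesis by blast
  qed
  then obtain g where g: "\<And>x. x \<in> X \<Longrightarrow> g x \<in> N x" "\<And>x. x \<in> X \<Longrightarrow> ?h x (g x) \<le> U x" by metis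
  define Y where "Y x k = (g ^^ k) x" for x k
  have gX: "g x \<in> X" if "x \<in> X" for x using N_in_X g(1) that by blast
  have YX: "Y x k \<in> X" if "x \<in> X" for x k
    using that by (induction k) (auto simp: Y_def gX)
  have Y_path: "is_path X N (Y x)" if "x \<in> X" for x
    using YX[OF that] g(1) by (simp add: is_path_def Y_def)
  have Y_Suc: "(\<lambda>k. Y x (Suc k)) = Y (g x)" for x
    by (simp add: Y_def fun_eq_iff funpow_swap1)
  \<comment> \<open>The path \<open>Y x\<close> obeys the recursion exactly and \<open>U\<close>
    obeys it as an inequality at the same successor \<open>g x\<close>; subtracting cancels the
    transition and terminal costs.\<close>
  have "J p (Y x) - U x \<le> 0"
  proof (rule contracting_imp_nonpos[where c = "1 - p" and X = X and D = "\<lambda>x. J p (Y x) - U x"])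
    fix x assume x: "x \<in> X"
    have "J p (Y x) = K x (g x) + p * q (g x) + (1 - p) * J p (Y (g x))"
      using expected_cost_Suc[OF p Y_path[OF x]] by (simp add: Y_Suc) (simp add: Y_def)
    hence "J p (Y x) - U x \<le> (1 - p) * (J p (Y (g x)) - U (g x))"
      using g(2)[OF x] by (simp add: algebra_simps)
    with gX[OF x] show "\<exists>z\<in>X. J p (Y x) - U x \<le> (1 - p) * (J p (Y z) - U z)" by blast
  qed (use finX p x in auto)
  moreover have "U x \<le> J p y'" if "is_path X N y'" "y' 0 = x" for y'
    using U_le that by blast
  ultimately show ?thesis
    using Y_path[OF x] by (intro exI[of _ "Y x"]) (force simp: Y_def)
qed

lemma W_rand_attained:
  assumes p: "p \<in> {0<..<1}" and x: "x \<in> X"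
  obtains y where "is_path X N y" "y 0 = x" "J p y = W p x"
    "\<And>y'. is_path X N y' \<Longrightarrow> y' 0 = x \<Longrightarrow> W p x \<le> J p y'"
proof -
  obtain y where y: "is_path X N y" "y 0 = x"
      "\<And>y'. is_path X N y' \<Longrightarrow> y' 0 = x \<Longrightarrow> J p y \<le> J p y'"
    using optimal_path_exists[OF p x] by blast
  have "W p x = V_rand X N K q p x" using p by (simp add: V_def)
  also have "\<dots> = J p y"
    unfolding V_rand_def by (rule Least_equality) (use y in auto)
  finally show thesis using that y by auto
qed

lemma W_rand_le: "p \<in> {0<..<1} \<Longrightarrow> is_path X N y \<Longrightarrow> W p (y 0) \<le> J p y"
  by (metis W_rand_attained is_path_def)

lemma W_rand_le_step:
  assumes p: "p \<in> {0<..<1}" and x: "x \<in> X" and z: "z \<in> N x"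
  shows "W p x \<le> K x z + p * q z + (1 - p) * W p z"
proof -
  obtain y where y: "is_path X N y" "y 0 = z" "J p y = W p z"
    using W_rand_attained[OF p N_in_X[OF x z]] by blast
  have path: "is_path X N (case_nat x y)"
    by (rule is_path_case_nat) (use y x z in simp_all)
  show ?thesis using W_rand_le[OF p path] expected_cost_Suc[OF p path] y by simp
qed

text \<open>The first transition of an optimal path attains the Bellman minimum. In the comparisons
  this equation is used for the larger function, and the one-step inequality for the smaller one at
  the same \<open>z\<close>.\<close>

lemma W_rand_greedy:
  assumes p: "p \<in> {0<..<1}" and x: "x \<in> X"
  obtains z where "z \<in> N x" "z \<in> X" "W p x = K x z + p * q z + (1 - p) * W p z"
proof -
  obtain y where y: "is_path X N y" "y 0 = x" "J p y = W p x"
    using W_rand_attained[OF p x] by blast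
  have z: "y 1 \<in> N x" using y by (metis is_path_def One_nat_def)
  have "(1 - p) * W p (y 1) \<le> (1 - p) * J p (\<lambda>k. y (Suc k))"
    using W_rand_le[OF p is_path_Suc[OF y(1)]] p by (intro mult_left_mono) auto
  hence "W p x = K x (y 1) + p * q (y 1) + (1 - p) * W p (y 1)"
    using expected_cost_Suc[OF p y(1)] y W_rand_le_step[OF p x z] by simp
  thus thesis using that z N_in_X[OF x z] by blast
qed

lemma W_rand_le_q: "p \<in> {0<..<1} \<Longrightarrow> x \<in> X \<Longrightarrow> W p x \<le> q x"
  using W_rand_le[OF _ is_path_const] expected_cost_const by fastforce

section \<open>The value function at p = 1\<close>

lemma W_1: "W 1 x = Min ((\<lambda>z. K x z + q z) ` N x)"
  by (simp add: V_def V_one_def)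

lemma W_1_le: "x \<in> X \<Longrightarrow> z \<in> N x \<Longrightarrow> W 1 x \<le> K x z + q z"
  by (simp add: W_1 finite_N)

lemma W_1_attained:
  assumes "x \<in> X"
  obtains z where "z \<in> N x" "W 1 x = K x z + q z"
proof -
  have "W 1 x \<in> (\<lambda>z. K x z + q z) ` N x"
    unfolding W_1 using assms finite_N refl_N by (intro Min_in) auto
  thus thesis using that by blast
qed

lemma W_1_le_q: "x \<in> X \<Longrightarrow> W 1 x \<le> q x"
  using W_1_le[of x x] refl_N K_refl by simp

section \<open>Undiscounted optimal stopping, p = 0\<close>

text \<open>
  A cycle of cost \<open>0\<close> prevents a direct induction along optimal transitions. Instead, among the
  nodes \<open>B\<close> where the infimum is not attained, the cheapest way to stop in \<open>B\<close> or to leave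
  \<open>B\<close> is an attained infimum, as in Dijkstra's algorithm.
\<close>

lemma optimal_stopping_exists:
  assumes x: "x \<in> X"
  shows "\<exists>m y. is_finite_path X N m y \<and> y 0 = x \<and>
    (\<forall>m' y'. is_finite_path X N m' y' \<and> y' 0 = x \<longrightarrow> path_cost K q y m \<le> path_cost K q y' m')"
proof -
  define S where "S x = {path_cost K q y m | y m. is_finite_path X N m y \<and> y 0 = x}" for x
  define U where "U x = Inf (S x)" for x
  obtain C where C: "\<And>x. x \<in> X \<Longrightarrow> \<bar>q x\<bar> \<le> C" using q_bounded by metis
  have bdd: "bdd_below (S x)" for x
    unfolding S_def by (rule bdd_belowI[of _ "- C"]) (use path_cost_ge[of "- C"] C in force)
  have U_le: "U x \<le> s" if "s \<in> S x" for x s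
    unfolding U_def by (rule cInf_lower[OF that bdd])
  have qS: "q x \<in> S x" if "x \<in> X" for x
    unfolding S_def using that
    by (auto simp: is_finite_path_def intro!: exI[of _ "\<lambda>_. x"] exI[of _ 0])
  have KS: "K x z + s \<in> S x" if "x \<in> X" "z \<in> N x" "s \<in> S z" for x z s
  proof -
    obtain y m where y: "is_finite_path X N m y" "y 0 = z" "s = path_cost K q y m"
      using \<open>s \<in> S z\<close> by (auto simp: S_def)
    have "path_cost K q (case_nat x y) (Suc m) = K x z + s" by (simp add: path_cost_Suc y)
    moreover have "is_finite_path X N (Suc m) (case_nat x y)"
      by (rule is_finite_path_case_nat) (use y that in simp_all)
    ultimately have "\<exists>y' m'. K x z + s = path_cost K q y' m' \<and> is_finite_path X N m' y' \<and> y' 0 = x"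
      by (intro exI[of _ "case_nat x y"] exI[of _ "Suc m"]) simp
    thus ?thesis by (simp add: S_def)
  qed
  define B where "B = {x \<in> X. U x \<notin> S x}"
  \<comment> \<open>The ways out at \<open>u\<close>: stop there, or move to a node where the
    infimum is attained.\<close>
  define R where "R u = insert (q u) ((\<lambda>v. K u v + U v) ` (N u - B))" for u
  have "B = {}"
  proof (rule ccontr)
    assume "B \<noteq> {}"
    have fin: "finite (\<Union>u\<in>B. R u)" "(\<Union>u\<in>B. R u) \<noteq> {}"
      using \<open>B \<noteq> {}\<close> finX finite_N by (auto simp: B_def R_def)
    define c where "c = Min (\<Union>u\<in>B. R u)"
    have c_le: "c \<le> r" if "u \<in> B" "r \<in> R u" for u r
      unfolding c_def using fin that by (intro Min_le) auto
    \<comment> \<open>A finite path starting in \<open>B\<close> either stops in \<open>B\<close> or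
      leaves it; the transitions made before that have nonnegative cost, and the way out costs at
      least \<open>c\<close>.\<close>
    have c_le_S: "c \<le> path_cost K q y m" if "is_finite_path X N m y" "y 0 \<in> B" for y m
      using that
    proof (induction m arbitrary: y)
      case 0
      thus ?case using c_le[of "y 0" "q (y 0)"] by (simp add: R_def)
    next
      case (Suc m)
      let ?s = "\<lambda>k. y (Suc k)"
      have y: "y 0 \<in> X" "y 1 \<in> X" "y 1 \<in> N (y 0)"
        using Suc.prems by (auto simp: is_finite_path_def)
      have s: "is_finite_path X N m ?s" using Suc.prems(1) by (rule is_finite_path_Suc)
      show ?case
      proof (cases "y 1 \<in> B")
        case True
        hence "c \<le> path_cost K q ?s m" using Suc.IH[OF s] by simp
        thus ?thesis using K_nonneg[OF y(1,3)] by (simp add: path_cost_Suc)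
      next
        case False
        hence "c \<le> K (y 0) (y 1) + U (y 1)"
          using y(3) by (intro c_le[OF Suc.prems(2)]) (auto simp: R_def)
        moreover have "U (y 1) \<le> path_cost K q ?s m"
          by (rule U_le) (use s in \<open>auto simp: S_def\<close>)
        ultimately show ?thesis by (simp add: path_cost_Suc)
      qed
    qed
    \<comment> \<open>At a node \<open>u\<close> with the cheapest way out, \<open>c\<close> is the
      cost of an actual path and also a lower bound for all paths from \<open>u\<close>, so the
      infimum at \<open>u\<close> is attained after all.\<close>
    obtain u where u: "u \<in> B" "c \<in> R u" using Min_in[OF fin] by (auto simp: c_def)
    have uX: "u \<in> X" "U u \<notin> S u" using u(1) by (auto simp: B_def)
    have "c \<in> S u"
      using u(2) uX(1) qS KS N_in_X by (auto simp: R_def B_def)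
    moreover have "c \<le> U u"
      unfolding U_def
      by (rule cInf_greatest) (use \<open>c \<in> S u\<close> c_le_S u(1) in \<open>auto simp: S_def\<close>)
    ultimately show False using U_le[of c u] uX by simp
  qed
  hence "U x \<in> S x" using x by (auto simp: B_def)
  then obtain y m where y: "is_finite_path X N m y" "y 0 = x" "U x = path_cost K q y m"
    by (auto simp: S_def)
  have "U x \<le> path_cost K q y' m'" if "is_finite_path X N m' y'" "y' 0 = x" for m' y'
    by (rule U_le) (use that in \<open>auto simp: S_def\<close>)
  with y show ?thesis by metis
qed

lemma W_0_attained:
  assumes x: "x \<in> X"
  obtains y m where "is_finite_path X N m y" "y 0 = x" "path_cost K q y m = W 0 x"
    "\<And>y' m'. is_finite_path X N m' y' \<Longrightarrow> y' 0 = x \<Longrightarrow> W 0 x \<le> path_cost K q y' m'"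
proof -
  obtain y m where y: "is_finite_path X N m y" "y 0 = x"
      "\<And>y' m'. is_finite_path X N m' y' \<Longrightarrow> y' 0 = x \<Longrightarrow> path_cost K q y m \<le> path_cost K q y' m'"
    using optimal_stopping_exists[OF x] by blast
  have "W 0 x = V_stop X N K q x" by (simp add: V_def)
  also have "\<dots> = path_cost K q y m"
    unfolding V_stop_def by (rule Least_equality) (use y in auto)
  finally show thesis using that y by auto
qed

lemma W_0_le: "is_finite_path X N m y \<Longrightarrow> W 0 (y 0) \<le> path_cost K q y m"
  by (metis W_0_attained is_finite_path_def le0)

lemma W_0_le_q: "x \<in> X \<Longrightarrow> W 0 x \<le> q x"
  using W_0_le[of 0 "\<lambda>_. x"] by (simp add: is_finite_path_def)

lemma W_0_le_step:
  assumes "x \<in> X" "z \<in> N x"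
  shows "W 0 x \<le> K x z + W 0 z"
proof -
  obtain y m where y: "is_finite_path X N m y" "y 0 = z" "path_cost K q y m = W 0 z"
    using W_0_attained[OF N_in_X[OF assms]] by metis
  have "is_finite_path X N (Suc m) (case_nat x y)"
    by (rule is_finite_path_case_nat) (use y assms in simp_all)
  from W_0_le[OF this] show ?thesis using y by (simp add: path_cost_Suc)
qed

section \<open>Comparison of the value functions in p\<close>

lemma W_0_le_rand:
  assumes p: "p \<in> {0<..<1}" and x: "x \<in> X"
  shows "W 0 x \<le> W p x"
proof -
  have "W 0 x - W p x \<le> 0"
  proof (rule contracting_imp_nonpos[where c = "1 - p" and X = X and D = "\<lambda>x. W 0 x - W p x"])
    fix x assume x: "x \<in> X"
    obtain z where z: "z \<in> N x" "z \<in> X" "W p x = K x z + p * q z + (1 - p) * W p z"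
      using W_rand_greedy[OF p x] .
    \<comment> \<open>Lowering the terminal term to \<open>p * W 0 z\<close> lets
      \<open>W 0 z\<close> be split with weights p and 1 - p; the p-parts then cancel.\<close>
    have "p * W 0 z \<le> p * q z" using W_0_le_q[OF z(2)] p by (intro mult_left_mono) auto
    hence "W 0 x - W p x \<le> (1 - p) * (W 0 z - W p z)"
      using z(3) W_0_le_step[OF x z(1)] by (simp add: algebra_simps)
    with z(2) show "\<exists>z\<in>X. W 0 x - W p x \<le> (1 - p) * (W 0 z - W p z)" by blast
  qed (use finX p x in auto)
  thus ?thesis by simp
qed

lemma W_rand_le_1:
  assumes p: "p \<in> {0<..<1}" and x: "x \<in> X"
  shows "W p x \<le> W 1 x"
proof -
  obtain z where z: "z \<in> N x" "W 1 x = K x z + q z" using W_1_attained[OF x] .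
  have "(1 - p) * W p z \<le> (1 - p) * q z"
    using W_rand_le_q[OF p N_in_X[OF x z(1)]] p by (intro mult_left_mono) auto
  thus ?thesis using W_rand_le_step[OF p x z(1)] z(2) by (simp add: algebra_simps)
qed

lemma W_rand_mono:
  assumes p1: "p1 \<in> {0<..<1}" and p2: "p2 \<in> {0<..<1}" and le: "p1 \<le> p2" and x: "x \<in> X"
  shows "W p1 x \<le> W p2 x"
proof -
  have "W p1 x - W p2 x \<le> 0"
  proof (rule contracting_imp_nonpos[where c = "1 - p2" and X = X and D = "\<lambda>x. W p1 x - W p2 x"])
    fix x assume x: "x \<in> X"
    obtain z where z: "z \<in> N x" "z \<in> X" "W p2 x = K x z + p2 * q z + (1 - p2) * W p2 z"
      using W_rand_greedy[OF p2 x] .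
    \<comment> \<open>Raising p moves the weight p2 - p1 from the continuation value to
      \<open>q z\<close>, which is at least as large.\<close>
    have "(p2 - p1) * W p1 z \<le> (p2 - p1) * q z"
      using W_rand_le_q[OF p1 z(2)] le by (intro mult_left_mono) auto
    hence "W p1 x - W p2 x \<le> (1 - p2) * (W p1 z - W p2 z)"
      using z(3) W_rand_le_step[OF p1 x z(1)] by (simp add: algebra_simps)
    with z(2) show "\<exists>z\<in>X. W p1 x - W p2 x \<le> (1 - p2) * (W p1 z - W p2 z)" by blast
  qed (use finX p2 x in auto)
  thus ?thesis by simp
qed

lemma W_le_q:
  assumes "0 \<le> p" "p \<le> 1" "x \<in> X"
  shows "W p x \<le> q x"
proof -
  consider "p = 0" | "p = 1" | "p \<in> {0<..<1}" using assms by force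
  thus ?thesis by cases (use assms W_0_le_q W_1_le_q W_rand_le_q in auto)
qed

lemma W_mono:
  assumes "0 \<le> p1" "p1 \<le> p2" "p2 \<le> 1" and x: "x \<in> X"
  shows "W p1 x \<le> W p2 x"
proof -
  \<comment> \<open>The endpoints 0 and 1 are compared through an arbitrary interior value.\<close>
  have half: "(1 / 2 :: real) \<in> {0<..<1}" by simp
  consider "p1 = p2" | "p1 = 0" "p2 = 1" | "p1 = 0" "p2 \<in> {0<..<1}"
    | "p1 \<in> {0<..<1}" "p2 = 1" | "p1 \<in> {0<..<1}" "p2 \<in> {0<..<1}" using assms by force
  thus ?thesis
    by cases (use order.trans[OF W_0_le_rand[OF half x] W_rand_le_1[OF half x]]
        W_0_le_rand W_rand_le_1 W_rand_mono assms in auto)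
qed

text \<open>Since V^p <= q throughout, V^p cannot leave the value q when it increases with
  p.\<close>

lemma motionless_set_mono:
  assumes "0 \<le> p1" "p1 \<le> p2" "p2 \<le> 1"
  shows "motionless_set X N K q p1 \<subseteq> motionless_set X N K q p2"
  unfolding motionless_set_def
  using W_mono[OF assms] W_le_q[of p2] assms by (force intro: antisym)

section \<open>Limits at the endpoints\<close>

text \<open>Uniformity in p is the point: by monotonicity the gap is largest at p = 0.\<close>

lemma q_minus_W_bounded:
  obtains C where "0 \<le> C" "\<And>p x. 0 \<le> p \<Longrightarrow> p \<le> 1 \<Longrightarrow> x \<in> X \<Longrightarrow> q x - W p x \<le> C"
proof (rule that)
  let ?C = "\<Sum>x\<in>X. q x - W 0 x"
  show "0 \<le> ?C" using W_0_le_q by (intro sum_nonneg) auto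
  fix p :: real and x assume *: "0 \<le> p" "p \<le> 1" "x \<in> X"
  have "q x - W 0 x \<le> ?C"
    using W_0_le_q * finX by (intro member_le_sum[of x X "\<lambda>x. q x - W 0 x"]) auto
  thus "q x - W p x \<le> ?C" using W_mono[of 0 p x] * by simp
qed

lemma tendsto_W_1:
  assumes x: "x \<in> X"
  shows "((\<lambda>p. W p x) \<longlongrightarrow> W 1 x) (at_left 1)"
proof -
  obtain C where C: "0 \<le> C" "\<And>p x. 0 \<le> p \<Longrightarrow> p \<le> 1 \<Longrightarrow> x \<in> X \<Longrightarrow> q x - W p x \<le> C"
    using q_minus_W_bounded by metis
  have ev: "eventually (\<lambda>p::real. p \<in> {0<..<1}) (at_left 1)"
    by (rule eventually_at_leftI[of 0]) auto
  have low: "W 1 x - (1 - p) * C \<le> W p x" if p: "p \<in> {0<..<1}" for p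
  proof -
    obtain z where z: "z \<in> N x" "z \<in> X" "W p x = K x z + p * q z + (1 - p) * W p z"
      using W_rand_greedy[OF p x] .
    have "(1 - p) * (q z - W p z) \<le> (1 - p) * C"
      using C(2)[OF _ _ z(2)] p by (intro mult_left_mono) auto
    thus ?thesis using W_1_le[OF x z(1)] z(3) by (simp add: algebra_simps)
  qed
  show ?thesis
  proof (rule tendsto_sandwich)
    show "eventually (\<lambda>p. W 1 x - (1 - p) * C \<le> W p x) (at_left 1)"
      using ev by eventually_elim (rule low)
    show "eventually (\<lambda>p. W p x \<le> W 1 x) (at_left 1)"
      using ev by eventually_elim (rule W_rand_le_1[OF _ x])
    show "((\<lambda>p. W 1 x - (1 - p) * C) \<longlongrightarrow> W 1 x) (at_left 1)"
      by (auto intro!: tendsto_eq_intros)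
  qed simp
qed

text \<open>Following a finite path, each transition risks termination with probability p, and
  terminating at a node instead of continuing optimally costs at most C more.\<close>

lemma W_rand_le_path_cost:
  assumes p: "p \<in> {0<..<1}" and C: "\<And>x. x \<in> X \<Longrightarrow> q x - W p x \<le> C"
    and "is_finite_path X N m y"
  shows "W p (y 0) \<le> path_cost K q y m + real m * (p * C)"
  using assms(3)
proof (induction m arbitrary: y)
  case 0
  thus ?case using W_rand_le_q[OF p] by (simp add: is_finite_path_def)
next
  case (Suc m)
  have y: "y 0 \<in> X" "y 1 \<in> X" "y 1 \<in> N (y 0)"
    using Suc.prems by (auto simp: is_finite_path_def)
  have "W p (y 1) \<le> path_cost K q (\<lambda>k. y (Suc k)) m + real m * (p * C)"
    using Suc.IH[OF is_finite_path_Suc[OF Suc.prems]] by simp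
  moreover have "p * (q (y 1) - W p (y 1)) \<le> p * C"
    using C[OF y(2)] p by (intro mult_left_mono) auto
  ultimately show ?case
    using W_rand_le_step[OF p y(1,3)] by (simp add: path_cost_Suc algebra_simps)
qed

lemma tendsto_W_0:
  assumes x: "x \<in> X"
  shows "((\<lambda>p. W p x) \<longlongrightarrow> W 0 x) (at_right 0)"
proof -
  obtain C where C: "0 \<le> C" "\<And>p x. 0 \<le> p \<Longrightarrow> p \<le> 1 \<Longrightarrow> x \<in> X \<Longrightarrow> q x - W p x \<le> C"
    using q_minus_W_bounded by metis
  \<comment> \<open>The stopping path, and with it \<open>m\<close>, is chosen before p, so the
    error m p C vanishes as p tends to 0.\<close>
  obtain y m where y: "is_finite_path X N m y" "y 0 = x" "path_cost K q y m = W 0 x"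
    using W_0_attained[OF x] by metis
  have ev: "eventually (\<lambda>p::real. p \<in> {0<..<1}) (at_right 0)"
    by (rule eventually_at_rightI[of _ 1]) auto
  have up: "W p x \<le> W 0 x + real m * (p * C)" if p: "p \<in> {0<..<1}" for p
    using W_rand_le_path_cost[OF p C(2) y(1)] p y by simp
  show ?thesis
  proof (rule tendsto_sandwich)
    show "eventually (\<lambda>p. W 0 x \<le> W p x) (at_right 0)"
      using ev by eventually_elim (rule W_0_le_rand[OF _ x])
    show "eventually (\<lambda>p. W p x \<le> W 0 x + real m * (p * C)) (at_right 0)"
      using ev by eventually_elim (rule up)
    show "((\<lambda>p. W 0 x + real m * (p * C)) \<longlongrightarrow> W 0 x) (at_right 0)"
      by (auto intro!: tendsto_eq_intros)
  qed simp
qed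

section \<open>Motionless sets near the endpoints\<close>

lemma strict_motionless_one_imp_motionless:
  assumes "x \<in> strict_motionless_one X N K q"
  shows "\<exists>p0\<in>{0<..<1}. \<forall>p\<in>{p0..<1}. x \<in> motionless_set X N K q p"
proof -
  have x: "x \<in> X" and gap: "\<And>z. z \<in> proper_succ N x \<Longrightarrow> q x < K x z + q z"
    using assms by (auto simp: strict_motionless_one_def)
  obtain C where C: "0 \<le> C" "\<And>p x. 0 \<le> p \<Longrightarrow> p \<le> 1 \<Longrightarrow> x \<in> X \<Longrightarrow> q x - W p x \<le> C"
    using q_minus_W_bounded by metis
  have "eventually (\<lambda>p. (1 - p) * C < K x z + q z - q x) (at_left 1)"
    if "z \<in> proper_succ N x" for z
    by (rule order_tendstoD(2)[where y = 0]) (use gap[OF that] in \<open>auto intro!: tendsto_eq_intros\<close>)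
  hence "eventually (\<lambda>p. \<forall>z\<in>proper_succ N x. (1 - p) * C < K x z + q z - q x) (at_left 1)"
    using finite_N[OF x] by (intro eventually_ball_finite) (auto simp: proper_succ_def)
  moreover have "eventually (\<lambda>p::real. p \<in> {0<..<1}) (at_left 1)"
    by (rule eventually_at_leftI[of 0]) auto
  ultimately have "eventually (\<lambda>p. p \<in> {0<..<1} \<and>
      (\<forall>z\<in>proper_succ N x. (1 - p) * C < K x z + q z - q x)) (at_left 1)"
    by eventually_elim auto
  from eventually_happens[OF this] obtain p where p: "p \<in> {0<..<1}"
    and small: "\<And>z. z \<in> proper_succ N x \<Longrightarrow> (1 - p) * C < K x z + q z - q x" by auto
  obtain z where z: "z \<in> N x" "z \<in> X" "W p x = K x z + p * q z + (1 - p) * W p z"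
    using W_rand_greedy[OF p x] .
  \<comment> \<open>Moving to another node costs at least \<open>K x z + q z - (1 - p) * C\<close>,
    which exceeds \<open>q x\<close> for this p; so the greedy choice is to stay.\<close>
  have "z = x"
  proof (rule ccontr)
    assume "z \<noteq> x"
    hence "(1 - p) * C < K x z + q z - q x" using z by (intro small) (simp add: proper_succ_def)
    moreover have "(1 - p) * (q z - W p z) \<le> (1 - p) * C"
      using C(2)[OF _ _ z(2)] p by (intro mult_left_mono) auto
    ultimately show False using z(3) W_rand_le_q[OF p x] by (simp add: algebra_simps)
  qed
  hence "p * W p x = p * q x" using z(3) K_refl[OF x] by (simp add: algebra_simps)
  hence "x \<in> motionless_set X N K q p" using p x by (simp add: motionless_set_def)
  hence "x \<in> motionless_set X N K q p'" if "p' \<in> {p..<1}" for p'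
    using motionless_set_mono[of p p'] p that by auto
  with p show ?thesis by blast
qed

lemma not_motionless_zero_imp_not_motionless:
  assumes "x \<in> X - motionless_set X N K q 0"
  shows "\<exists>p0\<in>{0<..<1}. \<forall>p\<in>{0<..p0}. x \<notin> motionless_set X N K q p"
proof -
  have x: "x \<in> X" "W 0 x < q x"
    using assms W_0_le_q[of x] by (auto simp: motionless_set_def)
  have "eventually (\<lambda>p. W p x < q x) (at_right 0)"
    using order_tendstoD(2)[OF tendsto_W_0[OF x(1)] x(2)] .
  moreover have "eventually (\<lambda>p::real. p \<in> {0<..<1}) (at_right 0)"
    by (rule eventually_at_rightI[of _ 1]) auto
  ultimately have "eventually (\<lambda>p. p \<in> {0<..<1} \<and> W p x < q x) (at_right 0)"
    by eventually_elim auto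
  from eventually_happens[OF this] obtain p where p: "p \<in> {0<..<1}" "W p x < q x" by auto
  hence "x \<notin> motionless_set X N K q p" by (simp add: motionless_set_def)
  hence "x \<notin> motionless_set X N K q p'" if "p' \<in> {0<..p}" for p'
    using motionless_set_mono[of p' p] p that by auto
  with p show ?thesis by blast
qed

section \<open>Optimal paths that become motionless\<close>

text \<open>Principle of optimality: the tail enters the cost with the positive factor 1 - p, so a
  tail that is not optimal would spoil the whole path.\<close>

lemma optimal_tail:
  assumes p: "p \<in> {0<..<1}" and y: "is_path X N y" and opt: "J p y = W p (y 0)"
  shows "J p (\<lambda>k. y (n + k)) = W p (y n)"
proof (induction n)
  case (Suc n)
  let ?s = "\<lambda>k. y (Suc n + k)"
  have path: "is_path X N (\<lambda>k. y (i + k))" for i using y by (simp add: is_path_def)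
  have yn: "y n \<in> X" "y (Suc n) \<in> N (y n)" using y by (auto simp: is_path_def)
  have "(1 - p) * J p ?s \<le> (1 - p) * W p (y (Suc n))"
    using Suc.IH expected_cost_Suc[OF p path[of n]] W_rand_le_step[OF p yn] by simp
  hence "J p ?s \<le> W p (y (Suc n))" using p by simp
  thus ?case using W_rand_le[OF p path[of "Suc n"]] by simp
qed (use opt in simp)

lemma optimal_stop_le_q:
  assumes p: "p \<in> {0<..<1}" and y: "is_path X N y" and opt: "J p y = W p (y 0)"
    and m: "motionless_from y m" and "n \<le> m"
  shows "path_cost K q (\<lambda>k. y (n + k)) (m - n) \<le> q (y n)"
proof -
  let ?c = "\<lambda>n. path_cost K q (\<lambda>k. y (n + k)) (m - n)"
  have yX: "y k \<in> X" for k using y by (simp add: is_path_def)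
  \<comment> \<open>Both bounds are carried backwards from m together, because W p at a node of the
    path averages q and W p at the next one.\<close>
  have "?c n \<le> W p (y n) \<and> ?c n \<le> q (y n)"
    using \<open>n \<le> m\<close>
  proof (induction rule: inc_induct)
    case base
    have "(\<lambda>k. y (m + k)) = (\<lambda>_. y m)"
      using m by (intro ext) (metis motionless_from_def le_add1)
    thus ?case
      using optimal_tail[OF p y opt, of m] expected_cost_const[OF p yX, of m] by simp
  next
    case (step n)
    let ?u = "y (Suc n)"
    have "J p (\<lambda>k. y (n + k)) = K (y n) ?u + p * q ?u + (1 - p) * J p (\<lambda>k. y (Suc n + k))"
      using expected_cost_Suc[OF p, of "\<lambda>k. y (n + k)"] y by (simp add: is_path_def)
    hence W: "W p (y n) = K (y n) ?u + p * q ?u + (1 - p) * W p ?u"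
      unfolding optimal_tail[OF p y opt] .
    have "p * ?c (Suc n) \<le> p * q ?u" "(1 - p) * ?c (Suc n) \<le> (1 - p) * W p ?u"
      using step.IH p by (auto intro!: mult_left_mono)
    hence "K (y n) ?u + ?c (Suc n) \<le> W p (y n)" unfolding W by (simp add: algebra_simps)
    moreover have "?c n = K (y n) ?u + ?c (Suc n)"
      using step.hyps path_cost_Suc[of K q "\<lambda>k. y (n + k)" "m - Suc n"] by (simp add: Suc_diff_Suc)
    ultimately show ?case using W_rand_le_q[OF p yX, of n] by simp
  qed
  thus ?thesis by simp
qed

lemma optimal_stop_cost_le:
  assumes "p \<in> {0<..<1}" "is_path X N y" "J p y = W p (y 0)" "motionless_from y m" "n \<le> m"
  shows "path_cost K q y m \<le> path_cost K q y n"
  using optimal_stop_le_q[OF assms] path_cost_split[OF assms(5), of K q y]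
  by (simp add: path_cost_def[of K q y n])

text \<open>The cost of the last transition is kept, since a positive lower bound for it makes the
  inequality between the terminal costs strict.\<close>

lemma optimal_stop_terminal_le:
  assumes "p \<in> {0<..<1}" "is_path X N y" "J p y = W p (y 0)" "motionless_from y m" "n < m"
  shows "q (y m) + K (y (m - 1)) (y m) \<le> q (y n)"
proof -
  let ?k = "\<lambda>k. K (y (n + k)) (y (n + Suc k))"
  have nn: "0 \<le> ?k i" for i using assms(2) by (auto simp: is_path_def intro!: K_nonneg)
  have "?k (m - n - 1) \<le> (\<Sum>k<m - n. ?k k)"
    using assms(5) nn by (intro member_le_sum) auto
  moreover have "n + (m - n - 1) = m - 1" "n + Suc (m - n - 1) = m" "n + (m - n) = m"
    using assms(5) by auto
  ultimately show ?thesis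
    using optimal_stop_le_q[OF assms(1-4), of n] assms(5) by (simp add: path_cost_def)
qed

section \<open>Minimizers of the terminal cost\<close>

lemma global_minimizers_motionless: "global_minimizers X q \<subseteq> motionless_set X N K q 0"
proof
  fix x assume "x \<in> global_minimizers X q"
  hence x: "x \<in> X" "\<And>z. z \<in> X \<Longrightarrow> q x \<le> q z" by (auto simp: global_minimizers_def)
  obtain y m where y: "is_finite_path X N m y" "path_cost K q y m = W 0 x"
    using W_0_attained[OF x(1)] by metis
  have "q x \<le> W 0 x" using path_cost_ge[OF x(2) y(1)] y(2) by simp
  thus "x \<in> motionless_set X N K q 0"
    using W_0_le_q[OF x(1)] x(1) by (simp add: motionless_set_def)
qed

lemma local_minimizers_motionless: "local_minimizers X N q \<subseteq> motionless_set X N K q 1"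
proof
  fix x assume "x \<in> local_minimizers X N q"
  hence x: "x \<in> X" "\<And>z. z \<in> N x \<Longrightarrow> q x \<le> q z" by (auto simp: local_minimizers_def)
  obtain z where z: "z \<in> N x" "W 1 x = K x z + q z" using W_1_attained[OF x(1)] .
  have "q x \<le> W 1 x" using x(2)[OF z(1)] K_nonneg[OF x(1) z(1)] z(2) by simp
  thus "x \<in> motionless_set X N K q 1"
    using W_1_le_q[OF x(1)] x(1) by (simp add: motionless_set_def)
qed

lemma motionless_one_local_minimizers:
  assumes "\<And>x z. x \<in> X \<Longrightarrow> z \<in> N x \<Longrightarrow> K x z = 0"
  shows "local_minimizers X N q = motionless_set X N K q 1"
proof
  show "motionless_set X N K q 1 \<subseteq> local_minimizers X N q"
    using W_1_le assms by (fastforce simp: motionless_set_def local_minimizers_def)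
qed (rule local_minimizers_motionless)

end

theorem theorem2p4:
  fixes X :: "'a set" and N :: "'a \<Rightarrow> 'a set"
    and K :: "'a \<Rightarrow> 'a \<Rightarrow> real" and q :: "'a \<Rightarrow> real" and \<Delta> :: real
  assumes finX: "finite X"
    and NX: "\<forall>x\<in>X. N x \<subseteq> X"
    and A1: "\<forall>x\<in>X. x \<in> N x"
    and A2: "\<forall>x\<in>X. K x x = 0"
    and A3: "\<Delta> \<ge> 0" "\<forall>x\<in>X. \<forall>z\<in>proper_succ N x. K x z \<ge> \<Delta>"
  shows
    "(\<forall>p\<in>{0<..<1}. \<forall>y m. p_optimal X N K q p y \<and> motionless_from y m \<longrightarrow>
        (\<forall>n<m. path_cost K q y m \<le> path_cost K q y n \<and> q (y m) \<le> q (y n)) \<and>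
        (\<Delta> > 0 \<and> (\<forall>k<m. \<not> motionless_from y k) \<longrightarrow> (\<forall>n<m. q (y m) < q (y n))))
   \<and> (\<forall>p\<in>{0<..<1}. \<forall>x\<in>X. V X N K q p x \<in> {V X N K q 0 x .. V X N K q 1 x})
   \<and> (\<forall>p1 p2. 0 < p1 \<and> p1 \<le> p2 \<and> p2 < 1 \<longrightarrow> (\<forall>x\<in>X. V X N K q p1 x \<le> V X N K q p2 x))
   \<and> (\<forall>x\<in>X. ((\<lambda>p. V X N K q p x) \<longlongrightarrow> V X N K q 1 x) (at_left 1))
   \<and> (\<forall>x\<in>X. ((\<lambda>p. V X N K q p x) \<longlongrightarrow> V X N K q 0 x) (at_right 0))
   \<and> (\<forall>p1 p2. 0 \<le> p1 \<and> p1 \<le> p2 \<and> p2 \<le> 1 \<longrightarrow>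
        motionless_set X N K q p1 \<subseteq> motionless_set X N K q p2)
   \<and> (\<forall>p\<in>{0<..<1}. motionless_set X N K q 0 \<subseteq> motionless_set X N K q p \<and>
        motionless_set X N K q p \<subseteq> motionless_set X N K q 1)
   \<and> (\<forall>x\<in>strict_motionless_one X N K q.
        \<exists>p0\<in>{0<..<1}. \<forall>p\<in>{p0..<1}. x \<in> motionless_set X N K q p)
   \<and> (\<forall>x\<in>X - motionless_set X N K q 0.
        \<exists>p0\<in>{0<..<1}. \<forall>p\<in>{0<..p0}. x \<notin> motionless_set X N K q p)
   \<and> global_minimizers X q \<subseteq> motionless_set X N K q 0
   \<and> local_minimizers X N q \<subseteq> motionless_set X N K q 1
   \<and> ((\<forall>x\<in>X. \<forall>z\<in>N x. K x z = 0) \<longrightarrow> local_minimizers X N q = motionless_set X N K q 1)"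
proof -
  have K_pos: "\<Delta> \<le> K x z" if "x \<in> X" "z \<in> N x" "z \<noteq> x" for x z
    using A3(2) that by (simp add: proper_succ_def)
  interpret stopping_problem X N K q
  proof
    show "0 \<le> K x z" if "x \<in> X" "z \<in> N x" for x z
      using K_pos[OF that] A2 A3(1) that by (cases "z = x") auto
  qed (use finX NX A1 A2 in auto)
  have opt_stop: "(\<forall>n<m. path_cost K q y m \<le> path_cost K q y n \<and> q (y m) \<le> q (y n)) \<and>
      (\<Delta> > 0 \<and> (\<forall>k<m. \<not> motionless_from y k) \<longrightarrow> (\<forall>n<m. q (y m) < q (y n)))"
    if p: "p \<in> {0<..<1}" and "p_optimal X N K q p y" and m: "motionless_from y m" for p y m
  proof -
    have y: "is_path X N y" "J p y = W p (y 0)" using that by (auto simp: p_optimal_def)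
    have yX: "y k \<in> X" "y (Suc k) \<in> N (y k)" for k using y(1) by (auto simp: is_path_def)
    note stop = optimal_stop_terminal_le[OF p y m]
    \<comment> \<open>The premise \<open>n < m\<close> excludes m = 0, where the truncated m - 1
      would not be a predecessor.\<close>
    have edge: "y m \<in> N (y (m - 1))" if "n < m" for n
      using yX(2)[of "m - 1"] that by simp
    have "q (y m) \<le> q (y n)" if "n < m" for n
      using stop[OF that] K_nonneg[OF yX(1) edge[OF that]] by simp
    moreover have "path_cost K q y m \<le> path_cost K q y n" if "n < m" for n
      using optimal_stop_cost_le[OF p y m] that by simp
    \<comment> \<open>Strictness calls for the first motionless time m: at a later one,
      \<open>y (m - 1)\<close> is the same node as \<open>y m\<close>. Minimality of m makes the
      last transition a genuine move, which costs at least Delta.\<close>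
    moreover have "q (y m) < q (y n)"
      if "\<Delta> > 0" "\<forall>k<m. \<not> motionless_from y k" "n < m" for n
    proof -
      have "y m \<noteq> y (m - 1)"
      proof
        assume eq: "y m = y (m - 1)"
        have "y k = y (m - 1)" if "m - 1 \<le> k" for k
          using that m eq by (cases "k = m - 1") (auto simp: motionless_from_def)
        hence "motionless_from y (m - 1)" unfolding motionless_from_def by blast
        with that(2,3) show False by simp
      qed
      hence "\<Delta> \<le> K (y (m - 1)) (y m)" using K_pos[OF yX(1) edge[OF that(3)]] by simp
      thus ?thesis using stop[OF that(3)] that(1) by simp
    qed
    ultimately show ?thesis by blast
  qed
  show ?thesis
  proof (intro conjI)
    show "\<forall>p\<in>{0<..<1}. \<forall>y m. p_optimal X N K q p y \<and> motionless_from y m \<longrightarrow>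
        (\<forall>n<m. path_cost K q y m \<le> path_cost K q y n \<and> q (y m) \<le> q (y n)) \<and>
        (\<Delta> > 0 \<and> (\<forall>k<m. \<not> motionless_from y k) \<longrightarrow> (\<forall>n<m. q (y m) < q (y n)))"
      using opt_stop by blast
    show "\<forall>p\<in>{0<..<1}. motionless_set X N K q 0 \<subseteq> motionless_set X N K q p \<and>
        motionless_set X N K q p \<subseteq> motionless_set X N K q 1"
      using motionless_set_mono by simp
    show "\<forall>x\<in>strict_motionless_one X N K q.
        \<exists>p0\<in>{0<..<1}. \<forall>p\<in>{p0..<1}. x \<in> motionless_set X N K q p"
      using strict_motionless_one_imp_motionless by blast
    show "\<forall>x\<in>X - motionless_set X N K q 0.
        \<exists>p0\<in>{0<..<1}. \<forall>p\<in>{0<..p0}. x \<notin> motionless_set X N K q p"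
      using not_motionless_zero_imp_not_motionless by blast
    show "\<forall>p1 p2. 0 \<le> p1 \<and> p1 \<le> p2 \<and> p2 \<le> 1 \<longrightarrow>
        motionless_set X N K q p1 \<subseteq> motionless_set X N K q p2"
      using motionless_set_mono by blast
    show "(\<forall>x\<in>X. \<forall>z\<in>N x. K x z = 0) \<longrightarrow> local_minimizers X N q = motionless_set X N K q 1"
      using motionless_one_local_minimizers by blast
  qed (use W_mono tendsto_W_0 tendsto_W_1 global_minimizers_motionless local_minimizers_motionless
      in auto)
qed

end
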